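(* Let $\sigma$ be drawn uniformly at random (probability $\frac1{J!}$ each) from the set $\{\sigma_1,\dots,\sigma_{J!}\}$ of all permutations of $\{1,\dots,J\}$, and let $B_\sigma$ be the operator of the successive subspace correction method using the order $\sigma$, i.e. $$I-B_\sigma A=(I-T_{\sigma(J)})(I-T_{\sigma(J-1)})\cdots(I-T_{\sigma(1)}).$$ Then $$E\big(\|I-B_\sigma A\|_A^2\big)=1-\frac1{J!}\sum_{i=1}^{J!}\frac1{c_{\sigma_i}},$$ where, for a permutation $\sigma$, $$c_\sigma=\sup_{\|v\|_A=1}\ \inf_{\sum_{i} v_i=v,\ v_i\in V_i}\ \sum_{i=1}^J\Big\|\overline T_{\sigma(i)}^{-1/2}\Big(v_{\sigma(i)}+T_{\sigma(i)}^*P_{\sigma(i)}\sum_{j>i}v_{\sigma(j)}\Big)\Big\|_A^2 .$$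
   Context: $V$ is a Hilbert space with inner product $(\cdot,\cdot)$, $A:V\to V$ is a symmetric positive definite linear operator, $(v,w)_A=(Av,w)$, $\|v\|_A^2=(v,v)_A$, and $\|\cdot\|_A$ also denotes the induced operator norm on $V$. The space is decomposed as $V=\sum_{i=1}^J V_i$ with subspaces $V_i\subset V$ (the sum need not be direct). For each $i$, the operators $Q_i,P_i:V\to V_i$ and $A_i:V_i\to V_i$ are defined by $(Q_iv,v_i)=(v,v_i)$, $(P_iv,v_i)_A=(v,v_i)_A$ for all $v\in V$, $v_i\in V_i$, and $(A_iw_i,v_i)=(Aw_i,v_i)$ for all $w_i,v_i\in V_i$. $R_i:V_i\to V_i$ is a given nonsingular linear operator (an approximation of $A_i^{-1}$). Define $T_i=R_iQ_iA=R_iA_iP_i$; $T_i^*$ is the adjoint of $T_i$ with respect to $(\cdot,\cdot)_A$; and $\overline T_i=T_i+T_i^*-T_i^*T_i$. The operator $\overline T_i$ restricted to $V_i$ is presupposed to be positive definite and invertible with respect to $(\cdot,\cdot)_A$, so that $\overline T_i^{-1/2}:V_i\to V_i$ makes sense. One pass of the method with permutation $\sigma$, starting from $u^m$, sets $v\leftarrow u^m$, then for $k=1,\dots,J$ replaces $v$ by $v+R_{\sigma(k)}Q_{\sigma(k)}(f-Av)$, and sets $u^{m+1}=v$; thus $u-u^{m+1}=(I-B_\sigma A)(u-u^m)$, where $Au=f$. *)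

theory Defs
  imports "HOL-Probability.Probability" "HOL-Combinatorics.Permutations"
begin

definition A_inner :: "('a::real_inner \<Rightarrow> 'a) \<Rightarrow> 'a \<Rightarrow> 'a \<Rightarrow> real" where
  "A_inner A v w = A v \<bullet> w"

definition A_norm :: "('a::real_inner \<Rightarrow> 'a) \<Rightarrow> 'a \<Rightarrow> real" where
  "A_norm A v = sqrt (A_inner A v v)"

text \<open>Like \<^const>\<open>onorm\<close>, with the energy norm; the vector 0 contributes 0 to the supremum.\<close>

definition A_onorm :: "('a::real_inner \<Rightarrow> 'a) \<Rightarrow> ('a \<Rightarrow> 'a) \<Rightarrow> real" where
  "A_onorm A T = (SUP v. A_norm A (T v) / A_norm A v)"

definition symmetric_pos_def :: "('a::real_inner \<Rightarrow> 'a) \<Rightarrow> bool" where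
  "symmetric_pos_def A \<longleftrightarrow>
     (\<forall>v w. A v \<bullet> w = v \<bullet> A w) \<and> (\<forall>v. v \<noteq> 0 \<longrightarrow> A v \<bullet> v > 0)"

text \<open>Operators on a subspace \<open>U\<close> are represented by functions on the whole space of which only
  the restriction to \<open>U\<close> matters.\<close>

definition linear_op_on :: "'a::real_vector set \<Rightarrow> ('a \<Rightarrow> 'a) \<Rightarrow> bool" where
  "linear_op_on U F \<longleftrightarrow> F ` U \<subseteq> U \<and>
     (\<forall>x\<in>U. \<forall>y\<in>U. F (x + y) = F x + F y) \<and> (\<forall>c. \<forall>x\<in>U. F (c *\<^sub>R x) = c *\<^sub>R F x)"

definition bounded_linear_op_on :: "'a::real_normed_vector set \<Rightarrow> ('a \<Rightarrow> 'a) \<Rightarrow> bool" where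
  "bounded_linear_op_on U F \<longleftrightarrow> linear_op_on U F \<and> (\<exists>K. \<forall>x\<in>U. norm (F x) \<le> K * norm x)"

text \<open>The projection onto \<open>U\<close> with respect to the inner product \<open>ip\<close>; the existence of the
  orthogonal projection onto \<open>U\<close> forces \<open>U\<close> to be closed.\<close>

definition is_projection :: "('a \<Rightarrow> 'a \<Rightarrow> real) \<Rightarrow> 'a set \<Rightarrow> ('a \<Rightarrow> 'a) \<Rightarrow> bool" where
  "is_projection ip U Q \<longleftrightarrow> (\<forall>v. Q v \<in> U \<and> (\<forall>w\<in>U. ip (Q v) w = ip v w))"

definition is_A_adjoint ::
    "('a::real_inner \<Rightarrow> 'a) \<Rightarrow> ('a \<Rightarrow> 'a) \<Rightarrow> ('a \<Rightarrow> 'a) \<Rightarrow> bool" where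
  "is_A_adjoint A T T' \<longleftrightarrow> (\<forall>v w. A_inner A (T v) w = A_inner A v (T' w))"

definition A_pos_def_on :: "('a::real_inner \<Rightarrow> 'a) \<Rightarrow> 'a set \<Rightarrow> ('a \<Rightarrow> 'a) \<Rightarrow> bool" where
  "A_pos_def_on A U X \<longleftrightarrow> (\<forall>x\<in>U. \<forall>y\<in>U. A_inner A (X x) y = A_inner A x (X y)) \<and>
     (\<forall>x\<in>U. x \<noteq> 0 \<longrightarrow> A_inner A (X x) x > 0)"

text \<open>\<open>S\<close> is the operator \<open>X\<close> to the power \<open>-1/2\<close> on \<open>U\<close>: the positive definite operator
  whose square is the inverse of \<open>X\<close>.\<close>

definition is_A_inv_sqrt ::
    "('a::real_inner \<Rightarrow> 'a) \<Rightarrow> 'a set \<Rightarrow> ('a \<Rightarrow> 'a) \<Rightarrow> ('a \<Rightarrow> 'a) \<Rightarrow> bool" where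
  "is_A_inv_sqrt A U X S \<longleftrightarrow> linear_op_on U S \<and> A_pos_def_on A U S \<and>
     (\<forall>x\<in>U. S (S (X x)) = x \<and> X (S (S x)) = x)"

definition Tsub :: "('a \<Rightarrow> 'a) \<Rightarrow> ('a \<Rightarrow> 'a) \<Rightarrow> ('a \<Rightarrow> 'a) \<Rightarrow> 'a \<Rightarrow> 'a" where
  "Tsub A R Q v = R (Q (A v))"

definition Tbar :: "('a::real_vector \<Rightarrow> 'a) \<Rightarrow> ('a \<Rightarrow> 'a) \<Rightarrow> 'a \<Rightarrow> 'a" where
  "Tbar T T' v = T v + T' v - T' (T v)"

text \<open>One pass in the order \<open>\<sigma> 1, \<dots>, \<sigma> J\<close> for the right-hand side \<open>f\<close>, started from \<open>v\<close>.\<close>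

definition ssc_pass ::
    "('a::real_vector \<Rightarrow> 'a) \<Rightarrow> (nat \<Rightarrow> 'a \<Rightarrow> 'a) \<Rightarrow> (nat \<Rightarrow> 'a \<Rightarrow> 'a) \<Rightarrow> nat \<Rightarrow> (nat \<Rightarrow> nat) \<Rightarrow> 'a \<Rightarrow> 'a \<Rightarrow> 'a"
  where "ssc_pass A R Q J \<sigma> f v =
    fold (\<lambda>k v. v + R (\<sigma> k) (Q (\<sigma> k) (f - A v))) [1..<Suc J] v"

definition ssc_B ::
    "('a::real_vector \<Rightarrow> 'a) \<Rightarrow> (nat \<Rightarrow> 'a \<Rightarrow> 'a) \<Rightarrow> (nat \<Rightarrow> 'a \<Rightarrow> 'a) \<Rightarrow> nat \<Rightarrow> (nat \<Rightarrow> nat) \<Rightarrow> 'a \<Rightarrow> 'a"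
  where "ssc_B A R Q J \<sigma> f = ssc_pass A R Q J \<sigma> f 0"

text \<open>The error after one pass; the fold applies the factor for \<open>\<sigma> 1\<close> first.\<close>

lemma ssc_pass_error:
  assumes "linear A"
  shows "u - ssc_pass A R Q J \<sigma> (A u) v =
    fold (\<lambda>k w. w - Tsub A (R (\<sigma> k)) (Q (\<sigma> k)) w) [1..<Suc J] (u - v)"
proof -
  have "u - fold (\<lambda>k v. v + R (\<sigma> k) (Q (\<sigma> k) (A u - A v))) ks v =
      fold (\<lambda>k w. w - Tsub A (R (\<sigma> k)) (Q (\<sigma> k)) w) ks (u - v)" for ks
    by (induction ks arbitrary: v)
      (simp_all add: Tsub_def linear_diff[OF assms] diff_diff_eq)
  then show ?thesis by (simp only: ssc_pass_def)
qed

corollary ssc_B_error: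
  assumes "linear A"
  shows "u - ssc_B A R Q J \<sigma> (A u) =
    fold (\<lambda>k w. w - Tsub A (R (\<sigma> k)) (Q (\<sigma> k)) w) [1..<Suc J] u"
  using ssc_pass_error[OF assms, of u R Q J \<sigma> 0] by (simp only: ssc_B_def diff_zero)

definition decompositions :: "(nat \<Rightarrow> 'a::real_vector set) \<Rightarrow> nat \<Rightarrow> 'a \<Rightarrow> (nat \<Rightarrow> 'a) set" where
  "decompositions V J v = {vs. (\<forall>i\<in>{1..J}. vs i \<in> V i) \<and> (\<Sum>i=1..J. vs i) = v}"

text \<open>Extended-real valued: the supremum may be infinite when \<open>A\<close> is not coercive, in which case
  \<open>1 / ssc_c \<dots> = 0\<close>. The arguments \<open>T'\<close> and \<open>S\<close> stand for the adjoints of the subspace operators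
  and for the inverse square roots of their symmetrizations.\<close>

definition ssc_c ::
    "('a::real_inner \<Rightarrow> 'a) \<Rightarrow> (nat \<Rightarrow> 'a set) \<Rightarrow> (nat \<Rightarrow> 'a \<Rightarrow> 'a) \<Rightarrow> (nat \<Rightarrow> 'a \<Rightarrow> 'a) \<Rightarrow>
     (nat \<Rightarrow> 'a \<Rightarrow> 'a) \<Rightarrow> nat \<Rightarrow> (nat \<Rightarrow> nat) \<Rightarrow> ereal" where
  "ssc_c A V P T' S J \<sigma> =
    (SUP v\<in>{v. A_norm A v = 1}. INF vs\<in>decompositions V J v.
      ereal (\<Sum>i=1..J. (A_norm A (S (\<sigma> i)
        (vs (\<sigma> i) + T' (\<sigma> i) (P (\<sigma> i) (\<Sum>j=i+1..J. vs (\<sigma> j))))))\<^sup>2))"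

end

theory Submission
  imports Defs
begin

text \<open>Write \<open>E\<^sub>i\<close> for the error operator after \<open>i\<close> steps and \<open>t\<^sub>i(x, y)\<close> for the semidefinite form
  \<open>(Tbar\<^sub>i x, y)\<^sub>A\<close>. Each step decreases the squared energy norm of the error \<open>e\<close> by \<open>t\<^sub>i(e, e)\<close>, so
  \<open>\<parallel>x\<parallel>\<^sup>2 - \<parallel>E\<^sub>J x\<parallel>\<^sup>2 = \<Sum> t\<^sub>i(E\<^bsub>i-1\<^esub> x, E\<^bsub>i-1\<^esub> x)\<close>. A decomposition of \<open>v\<close> corresponds, through the triangular
  system \<open>v\<^sub>i + T\<^sub>i\<^sup>* P\<^sub>i (\<Sum>j>i. v\<^sub>j) = Tbar\<^sub>i y\<^sub>i\<close>, to a family \<open>y\<close> with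
  \<open>(v, x)\<^sub>A = \<Sum> t\<^sub>i(y\<^sub>i, E\<^bsub>i-1\<^esub> x)\<close> for all \<open>x\<close>, and its cost is \<open>\<Sum> t\<^sub>i(y\<^sub>i, y\<^sub>i)\<close>. Cauchy-Schwarz at \<open>x = v\<close>
  bounds the cost from below. For the upper bound, the Riesz representation of \<open>(v, \<cdot>)\<^sub>A\<close> with
  respect to the form \<open>\<Sum> t\<^sub>i(E\<^bsub>i-1\<^esub> x, E\<^bsub>i-1\<^esub> z)\<close> yields a cheap \<open>y\<close>; the space need not be complete in
  this form, but every \<open>V\<^sub>i\<close> is complete with respect to \<open>t\<^sub>i\<close>, which is enough to pass to the
  limit in each component. Hence \<open>1 / c\<^sub>\<sigma> = 1 - \<parallel>E\<^sub>J\<parallel>\<^sup>2\<close> for every order \<open>\<sigma>\<close>.\<close>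

subsection \<open>Semidefinite forms\<close>

locale psd_form =
  fixes b :: "'a::real_vector \<Rightarrow> 'a \<Rightarrow> real"
  assumes add_left: "b (x + y) z = b x z + b y z"
    and scaleR_left: "b (c *\<^sub>R x) z = c * b x z"
    and sym: "b x y = b y x"
    and nonneg: "0 \<le> b x x"
begin

lemma add_right: "b z (x + y) = b z x + b z y"
  using add_left sym by metis

lemma scaleR_right: "b z (c *\<^sub>R x) = c * b z x"
  using scaleR_left sym by metis

lemma zero_left [simp]: "b 0 x = 0"
  using scaleR_left[of 0 0 x] by simp

lemma zero_right [simp]: "b x 0 = 0"
  using sym by simp

lemma diff_left: "b (x - y) z = b x z - b y z"
  using add_left[of "x - y" y z] by simp

lemma diff_right: "b z (x - y) = b z x - b z y"
  using diff_left sym by metis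

lemmas bilinear_simps = add_left add_right scaleR_left scaleR_right diff_left diff_right

text \<open>The form may be degenerate, so \<open>b y y = 0\<close> is treated apart: the quadratic
  in \<open>t\<close> is then affine, and an affine function bounded below on the whole line has
  slope zero.\<close>

lemma Cauchy_Schwarz: "(b x y)\<^sup>2 \<le> b x x * b y y"
proof -
  have quad: "0 \<le> b x x - 2 * t * b x y + t\<^sup>2 * b y y" for t
    using nonneg[of "x - t *\<^sub>R y"] sym[of y x]
    by (simp add: bilinear_simps algebra_simps power2_eq_square)
  show ?thesis
  proof (cases "b y y = 0")
    case True
    then have ineq: "0 \<le> b x x - 2 * t * b x y" for t
      using quad[of t] by simp
    have "b x y = 0"
    proof (rule ccontr)
      assume "b x y \<noteq> 0"
      \<comment> \<open>The chosen argument makes the affine function equal to -1.\<close>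
      then show False
        using ineq[of "(b x x + 1) / (2 * b x y)"] by simp
    qed
    then show ?thesis using True by simp
  next
    case False
    then have pos: "0 < b y y" using nonneg[of y] by simp
    \<comment> \<open>The value \<open>t = b x y / b y y\<close> minimizes the quadratic.\<close>
    have "0 \<le> b y y * (b x x - 2 * (b x y / b y y) * b x y + (b x y / b y y)\<^sup>2 * b y y)"
      using quad[of "b x y / b y y"] pos by (intro mult_nonneg_nonneg) auto
    also have "\<dots> = b x x * b y y - (b x y)\<^sup>2"
      using pos by (simp add: field_simps power2_eq_square)
    finally show ?thesis by simp
  qed
qed

lemma Cauchy_Schwarz_sqrt: "\<bar>b x y\<bar> \<le> sqrt (b x x) * sqrt (b y y)"
  by (metis Cauchy_Schwarz real_sqrt_abs real_sqrt_le_mono real_sqrt_mult)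

text \<open>Riesz representation without completeness: the representing vector is replaced by a
  Cauchy sequence that converges weakly to it. It is a maximizing sequence of \<open>2 l x - b x x\<close>;
  rescaling each member optimally along its ray keeps the norms below that of \<open>l\<close>.\<close>

lemma Riesz_sequence:
  assumes l_add: "\<And>x y. l (x + y) = l x + l y"
    and l_scaleR: "\<And>c x. l (c *\<^sub>R x) = c * l x"
    and l_bound: "\<And>x. \<bar>l x\<bar> \<le> C * sqrt (b x x)"
  obtains X :: "nat \<Rightarrow> 'a"
  where "\<And>n. b (X n) (X n) \<le> C\<^sup>2"
    and "\<And>e. e > 0 \<Longrightarrow> \<exists>N. \<forall>m\<ge>N. \<forall>n\<ge>N. b (X m - X n) (X m - X n) < e"
    and "\<And>z. (\<lambda>n. b (X n) z) \<longlonglongrightarrow> l z"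
proof -
  define \<phi> where "\<phi> x = 2 * l x - b x x" for x
  have l_sq: "(l x)\<^sup>2 \<le> C\<^sup>2 * b x x" for x
  proof -
    have "(l x)\<^sup>2 \<le> (C * sqrt (b x x))\<^sup>2"
      using l_bound[of x] by (metis abs_ge_zero power2_abs power_mono)
    then show ?thesis using nonneg[of x] by (simp add: power_mult_distrib)
  qed
  have rescale: "\<exists>y. \<phi> x \<le> \<phi> y \<and> b y y \<le> C\<^sup>2 \<and> \<phi> x \<le> C\<^sup>2" for x
  proof (cases "b x x = 0")
    case True
    then have "l x = 0" using l_sq[of x] by simp
    moreover have "l 0 = 0" using l_scaleR[of 0 0] by simp
    ultimately show ?thesis using True by (intro exI[of _ 0]) (simp add: \<phi>_def)
  next
    case False
    then have pos: "0 < b x x" using nonneg[of x] by simp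
    define y where "y = (l x / b x x) *\<^sub>R x"
    have byy: "b y y = (l x)\<^sup>2 / b x x" and ly: "l y = (l x)\<^sup>2 / b x x"
      using pos by (simp_all add: y_def bilinear_simps l_scaleR power2_eq_square)
    have "0 \<le> (l x - b x x)\<^sup>2 / b x x" using pos by simp
    also have "\<dots> = \<phi> y - \<phi> x"
      using pos by (simp add: \<phi>_def byy ly field_simps power2_eq_square)
    finally have "\<phi> x \<le> \<phi> y" by simp
    moreover have "b y y \<le> C\<^sup>2"
      using l_sq[of x] pos by (simp add: byy divide_le_eq)
    moreover have "\<phi> y = b y y" by (simp add: \<phi>_def byy ly)
    ultimately show ?thesis by (intro exI[of _ y]) auto
  qed
  define M where "M = (SUP x. \<phi> x)"
  have bdd: "bdd_above (range \<phi>)"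
    using rescale by (meson bdd_aboveI2)
  have \<phi>_le: "\<phi> x \<le> M" for x
    unfolding M_def by (rule cSUP_upper[OF _ bdd]) simp
  have "\<exists>x. M - inverse (Suc n) < \<phi> x \<and> b x x \<le> C\<^sup>2" for n
  proof -
    have "M - inverse (Suc n) < M" by simp
    then obtain x where "M - inverse (Suc n) < \<phi> x"
      unfolding M_def using less_cSUP_iff[OF _ bdd] by auto
    then show ?thesis using rescale[of x] by (meson less_le_trans)
  qed
  then obtain X where X: "M - inverse (Suc n) < \<phi> (X n)" "b (X n) (X n) \<le> C\<^sup>2" for n
    by metis
  have inv_le: "inverse (real (Suc n)) \<le> inverse (real (Suc N))" if "N \<le> n" for n N
    using that by (simp add: le_imp_inverse_le)
  have small: "\<exists>N. inverse (real (Suc N)) < e" if "e > 0" for e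
    using reals_Archimedean[OF that] .
  show thesis
  proof (rule that)
    fix e :: real assume "e > 0"
    then obtain N where N: "inverse (real (Suc N)) < e / 4" using small[of "e/4"] by auto
    have close: "M - e / 4 < \<phi> (X n)" if "N \<le> n" for n
      using X(1)[of n] le_less_trans[OF inv_le[OF that] N] by argo
    have "b (X m - X n) (X m - X n) < e" if "N \<le> m" "N \<le> n" for m n
    proof -
      \<comment> \<open>Concavity of \<open>\<phi>\<close> in exact form: the midpoint value exceeds
        the mean by a quarter of the squared distance and cannot exceed \<open>M\<close>, so almost
        maximal points are close together.\<close>
      have "\<phi> ((1/2) *\<^sub>R (X m + X n)) = (\<phi> (X m) + \<phi> (X n)) / 2 + b (X m - X n) (X m - X n) / 4"
        using sym[of "X n" "X m"]
        by (simp add: \<phi>_def bilinear_simps l_add l_scaleR) (simp add: field_simps)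
      then have "b (X m - X n) (X m - X n) / 4 \<le> M - (\<phi> (X m) + \<phi> (X n)) / 2"
        using \<phi>_le[of "(1/2) *\<^sub>R (X m + X n)"] by linarith
      also have "\<dots> < e / 4"
        using close[OF that(1)] close[OF that(2)] by argo
      finally show ?thesis by simp
    qed
    then show "\<exists>N. \<forall>m\<ge>N. \<forall>n\<ge>N. b (X m - X n) (X m - X n) < e" by blast
  next
    fix z
    \<comment> \<open>The best perturbation of \<open>X n\<close> along \<open>z\<close> has
      coefficient \<open>d / b z z\<close>; the summand 1 keeps the denominator positive when
      \<open>b z z = 0\<close>.\<close>
    define D where "D = b z z + 1"
    have D: "0 < D" using nonneg[of z] by (simp add: D_def)
    have bound: "(l z - b (X n) z)\<^sup>2 \<le> D * inverse (real (Suc n))" for n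
    proof -
      define d where "d = l z - b (X n) z"
      define t where "t = d / D"
      have "\<phi> (X n + t *\<^sub>R z) = \<phi> (X n) + 2 * t * d - t\<^sup>2 * b z z"
        using sym[of z "X n"]
        by (simp add: \<phi>_def d_def bilinear_simps l_add l_scaleR algebra_simps power2_eq_square)
      then have "2 * t * d - t\<^sup>2 * b z z \<le> inverse (real (Suc n))"
        using \<phi>_le[of "X n + t *\<^sub>R z"] X(1)[of n] by linarith
      moreover have "2 * t * d - t\<^sup>2 * b z z = d\<^sup>2 / D + t\<^sup>2"
      proof -
        have "2 * t * d - t\<^sup>2 * (D - 1) = d\<^sup>2 / D + t\<^sup>2"
          using D by (simp add: t_def field_simps power2_eq_square)
        then show ?thesis by (simp add: D_def)
      qed
      ultimately have "d\<^sup>2 / D \<le> inverse (real (Suc n))" using zero_le_power2[of t] by linarith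
      then show ?thesis using D by (simp add: d_def divide_le_eq mult.commute)
    qed
    have D_lim: "(\<lambda>n. D * inverse (real (Suc n))) \<longlonglongrightarrow> 0"
      using tendsto_mult[OF tendsto_const LIMSEQ_inverse_real_of_nat] by simp
    have "(\<lambda>n. (l z - b (X n) z)\<^sup>2) \<longlonglongrightarrow> 0"
    proof (rule tendsto_sandwich[OF _ _ tendsto_const D_lim])
      show "\<forall>\<^sub>F n in sequentially. 0 \<le> (l z - b (X n) z)\<^sup>2" by simp
      show "\<forall>\<^sub>F n in sequentially. (l z - b (X n) z)\<^sup>2 \<le> D * inverse (real (Suc n))"
        by (intro always_eventually allI bound)
    qed
    then have "(\<lambda>n. l z - b (X n) z) \<longlonglongrightarrow> 0"
      using tendsto_real_sqrt[of "\<lambda>n. (l z - b (X n) z)\<^sup>2" 0]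
      by (simp add: tendsto_rabs_zero_iff)
    then have "(\<lambda>n. l z - (l z - b (X n) z)) \<longlonglongrightarrow> l z - 0"
      by (intro tendsto_diff tendsto_const)
    then show "(\<lambda>n. b (X n) z) \<longlonglongrightarrow> l z" by simp
  qed (rule X(2))
qed

end

interpretation inner: psd_form "(\<bullet>) :: 'a::real_inner \<Rightarrow> 'a \<Rightarrow> real"
proof
  show "x \<bullet> y = y \<bullet> x" for x y :: 'a by (rule inner_commute)
qed (simp_all add: inner_add_left)

section \<open>Hilbert space tools: Riesz representation and uniform boundedness\<close>

text \<open>For the inner product itself, completeness gives the Cauchy sequence of
  \<open>Riesz_sequence\<close> a norm limit, which then represents the functional.\<close>

lemma Riesz_representation:
  fixes l :: "'a::{real_inner, complete_space} \<Rightarrow> real"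
  assumes "\<And>x y. l (x + y) = l x + l y"
    and "\<And>c x. l (c *\<^sub>R x) = c * l x"
    and "\<And>x. \<bar>l x\<bar> \<le> C * norm x"
  obtains g where "\<And>x. l x = g \<bullet> x"
proof -
  have "\<bar>l x\<bar> \<le> C * sqrt (x \<bullet> x)" for x
    using assms(3)[of x] by (simp add: norm_eq_sqrt_inner)
  then obtain X where "\<And>n. X n \<bullet> X n \<le> C\<^sup>2"
    and cau: "\<And>e. e > 0 \<Longrightarrow> \<exists>N. \<forall>m\<ge>N. \<forall>n\<ge>N. (X m - X n) \<bullet> (X m - X n) < e"
    and lim: "\<And>z. (\<lambda>n. X n \<bullet> z) \<longlonglongrightarrow> l z"
    by (rule inner.Riesz_sequence[OF assms(1,2)]) blast
  have "Cauchy X"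
  proof (rule metric_CauchyI)
    fix e :: real assume e: "e > 0"
    then obtain N where "\<forall>m\<ge>N. \<forall>n\<ge>N. (X m - X n) \<bullet> (X m - X n) < e\<^sup>2"
      using cau[of "e\<^sup>2"] by auto
    then show "\<exists>N. \<forall>m\<ge>N. \<forall>n\<ge>N. dist (X m) (X n) < e"
      using e by (metis dist_norm norm_eq_sqrt_inner real_less_lsqrt inner_ge_zero less_eq_real_def)
  qed
  then obtain g where g: "X \<longlonglongrightarrow> g"
    using Cauchy_convergent_iff convergentD by blast
  have "l x = g \<bullet> x" for x
    using LIMSEQ_unique[OF lim tendsto_inner[OF g tendsto_const]] .
  then show thesis by (rule that)
qed

text \<open>The uniform boundedness principle by Baire category: the closed sets \<open>F n\<close>
  cover the space, so one of them contains a ball.\<close>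

lemma weakly_bounded_imp_bounded:
  fixes B :: "'a::{real_inner, complete_space} set"
  assumes "\<And>y. \<exists>M. \<forall>x\<in>B. \<bar>x \<bullet> y\<bar> \<le> M"
  obtains C where "\<And>x. x \<in> B \<Longrightarrow> norm x \<le> C"
proof -
  define F where "F n = {y. \<forall>x\<in>B. \<bar>x \<bullet> y\<bar> \<le> real n}" for n
  have F_closed: "closed (F n)" for n
  proof -
    have "F n = (\<Inter>x\<in>B. {y. \<bar>x \<bullet> y\<bar> \<le> real n})" by (auto simp: F_def)
    then show ?thesis
      by (auto intro!: closed_INT closed_Collect_le continuous_intros)
  qed
  have "\<Union>(range F) = UNIV"
  proof -
    have "\<exists>n. y \<in> F n" for y
    proof -
      obtain M where M: "\<forall>x\<in>B. \<bar>x \<bullet> y\<bar> \<le> M" using assms by blast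
      obtain n where "M \<le> real n" using real_arch_simple by blast
      then show ?thesis using M by (auto simp: F_def intro: order_trans)
    qed
    then show ?thesis by auto
  qed
  moreover have "interior (\<Union>(range F)) = {}" if "\<And>n. interior (F n) = {}"
    using Baire_category_alt[of euclidean "range F"] F_closed that
    by (auto simp: completely_metrizable_space_euclidean)
  ultimately obtain n where "interior (F n) \<noteq> {}" by fastforce
  then obtain y e where e: "e > 0" "cball y e \<subseteq> F n"
    by (meson equals0I mem_interior_cball)
  have "norm x \<le> 2 * real n / e" if "x \<in> B" for x
  proof (cases "x = 0")
    case False
    \<comment> \<open>The vector \<open>z\<close> points along \<open>x\<close> and has length
      \<open>e\<close>, so \<open>y + z\<close> stays in the closed ball while
      \<open>x \<bullet> z = e * norm x\<close>.\<close>
    define z where "z = (e / norm x) *\<^sub>R x"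
    have "y + z \<in> cball y e" using e False by (simp add: z_def dist_norm)
    then have "\<bar>x \<bullet> (y + z)\<bar> \<le> real n" using e that by (auto simp: F_def)
    moreover have "\<bar>x \<bullet> y\<bar> \<le> real n" using e that by (force simp: F_def)
    ultimately have "x \<bullet> z \<le> 2 * real n" by (simp add: inner_add_right)
    moreover have "x \<bullet> z = e * norm x"
      using False by (simp add: z_def power2_norm_eq_inner[symmetric] power2_eq_square)
    ultimately show ?thesis using e by (simp add: field_simps)
  qed (use e in simp)
  then show thesis by (rule that)
qed

subsection \<open>One subspace\<close>

locale energy_space =
  fixes A :: "'a::{real_inner, complete_space} \<Rightarrow> 'a"
  assumes A_linear: "bounded_linear A"
    and A_spd: "symmetric_pos_def A"
begin

lemma A_symmetric: "A v \<bullet> w = v \<bullet> A w"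
  using A_spd by (simp add: symmetric_pos_def_def)

sublocale energy: psd_form "A_inner A"
proof
  show "A_inner A x y = A_inner A y x" for x y
    by (metis A_inner_def A_symmetric inner_commute)
  show "0 \<le> A_inner A x x" for x
    using A_spd linear_0[OF bounded_linear.linear[OF A_linear]]
    by (cases "x = 0") (auto simp: symmetric_pos_def_def A_inner_def less_imp_le)
qed (simp_all add: A_inner_def linear_add linear_scale bounded_linear.linear[OF A_linear] inner_add_left)

lemma A_inner_eq_0_iff: "A_inner A x x = 0 \<longleftrightarrow> x = 0"
  using A_spd by (auto simp: symmetric_pos_def_def A_inner_def dest: spec[of _ x])

lemma A_inner_eqI:
  assumes "\<And>z. A_inner A x z = A_inner A y z"
  shows "x = y"
  using assms[of "x - y"] A_inner_eq_0_iff[of "x - y"] by (simp add: energy.diff_left)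

lemma A_norm_power2: "(A_norm A v)\<^sup>2 = A_inner A v v"
  by (simp add: A_norm_def energy.nonneg)

lemma A_norm_eq_0_iff: "A_norm A v = 0 \<longleftrightarrow> v = 0"
  by (simp add: A_norm_def A_inner_eq_0_iff)

lemma A_norm_nonneg: "0 \<le> A_norm A v"
  by (simp add: A_norm_def energy.nonneg)

lemma A_norm_scaleR: "A_norm A (c *\<^sub>R v) = \<bar>c\<bar> * A_norm A v"
proof -
  have "A_inner A (c *\<^sub>R v) (c *\<^sub>R v) = c\<^sup>2 * A_inner A v v"
    by (simp add: energy.bilinear_simps power2_eq_square)
  then show ?thesis by (simp add: A_norm_def real_sqrt_mult)
qed

end

locale subspace_solver = energy_space A
  for A :: "'a::{real_inner, complete_space} \<Rightarrow> 'a" +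
  fixes U :: "'a set" and Q P R T' S :: "'a \<Rightarrow> 'a"
  assumes U_subspace: "subspace U"
    and Q_proj: "is_projection (\<bullet>) U Q"
    and P_proj: "is_projection (A_inner A) U P"
    and R_linear: "bounded_linear_op_on U R"
    and T_adjoint: "is_A_adjoint A (Tsub A R Q) T'"
    and Tbar_pos_def: "A_pos_def_on A U (Tbar (Tsub A R Q) T')"
    and Tbar_bij: "bij_betw (Tbar (Tsub A R Q) T') U U"
    and S_inv_sqrt: "is_A_inv_sqrt A U (Tbar (Tsub A R Q) T') S"
begin

abbreviation "T \<equiv> Tsub A R Q"
abbreviation "Tb \<equiv> Tbar T T'"

lemma Q_mem: "Q v \<in> U" and Q_inner: "w \<in> U \<Longrightarrow> Q v \<bullet> w = v \<bullet> w"
  using Q_proj by (auto simp: is_projection_def)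

lemma P_mem: "P v \<in> U" and P_inner: "w \<in> U \<Longrightarrow> A_inner A (P v) w = A_inner A v w"
  using P_proj by (auto simp: is_projection_def)

lemma R_mem: "x \<in> U \<Longrightarrow> R x \<in> U"
  and R_add: "x \<in> U \<Longrightarrow> y \<in> U \<Longrightarrow> R (x + y) = R x + R y"
  and R_scaleR: "x \<in> U \<Longrightarrow> R (c *\<^sub>R x) = c *\<^sub>R R x"
  using R_linear by (auto simp: bounded_linear_op_on_def linear_op_on_def)

text \<open>Uniqueness of the projection, from which its linearity and its action on
  \<open>U\<close> follow.\<close>

lemma Q_eqI:
  assumes "y \<in> U" "\<And>w. w \<in> U \<Longrightarrow> y \<bullet> w = v \<bullet> w"
  shows "Q v = y"
proof -
  have "Q v - y \<in> U" using U_subspace Q_mem assms(1) by (rule subspace_diff)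
  then have "(Q v - y) \<bullet> (Q v - y) = 0"
    using assms(2) Q_inner by (simp add: inner_diff_left)
  then show ?thesis by simp
qed

lemma Q_add: "Q (x + y) = Q x + Q y"
  by (rule Q_eqI) (simp_all add: Q_mem Q_inner inner_add_left subspace_add[OF U_subspace])

lemma Q_scaleR: "Q (c *\<^sub>R x) = c *\<^sub>R Q x"
  by (rule Q_eqI) (simp_all add: Q_mem Q_inner subspace_scale[OF U_subspace])

lemma Q_id: "x \<in> U \<Longrightarrow> Q x = x"
  by (rule Q_eqI) simp_all

lemma norm_Q_le: "norm (Q x) \<le> norm x"
proof (cases "Q x = 0")
  case False
  have "norm (Q x) * norm (Q x) = x \<bullet> Q x"
    using Q_inner[OF Q_mem, of x x] by (simp flip: power2_norm_eq_inner power2_eq_square)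
  also have "\<dots> \<le> norm x * norm (Q x)" by (rule norm_cauchy_schwarz)
  finally show ?thesis using False by simp
qed simp

lemma T_add: "T (x + y) = T x + T y"
  using A_linear
  by (simp add: Tsub_def linear_add bounded_linear.linear Q_add R_add Q_mem)

lemma T_scaleR: "T (c *\<^sub>R x) = c *\<^sub>R T x"
  using A_linear
  by (simp add: Tsub_def linear_scale bounded_linear.linear Q_scaleR R_scaleR Q_mem)

lemma T_mem: "T x \<in> U"
  by (simp add: Tsub_def Q_mem R_mem)

text \<open>Tested against \<open>U\<close>, the vector \<open>A x\<close> sees only the energy
  projection of \<open>x\<close>, so \<open>Q A P = Q A\<close>.\<close>

lemma T_P: "T (P x) = T x"
proof -
  have "Q (A (P x)) = Q (A x)"
    using P_inner Q_inner by (intro Q_eqI Q_mem) (simp add: A_inner_def)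
  then show ?thesis by (simp add: Tsub_def)
qed

lemma T'_inner: "A_inner A (T x) y = A_inner A x (T' y)"
  using T_adjoint by (simp add: is_A_adjoint_def)

lemma T'_inner': "A_inner A (T' x) y = A_inner A x (T y)"
  by (metis T'_inner energy.sym)

text \<open>Only the adjoint identity is known of \<open>T'\<close>. Since \<open>T P = T\<close>,
  passing to adjoints gives \<open>P T' = T'\<close>, which places the range in
  \<open>U\<close>.\<close>

lemma T'_mem: "T' x \<in> U"
proof -
  have "T' x = P (T' x)"
  proof (rule A_inner_eqI)
    fix z
    have "A_inner A (P (T' x)) z = A_inner A (P z) (T' x)"
      by (metis P_inner P_mem energy.sym)
    then show "A_inner A (T' x) z = A_inner A (P (T' x)) z"
      by (metis T'_inner T_P energy.sym)
  qed
  then show ?thesis by (metis P_mem)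
qed

lemma T'_P: "T' (P x) = T' x"
  by (rule A_inner_eqI) (simp add: T'_inner' P_inner T_mem)

lemma Tb_mem: "Tb x \<in> U"
  by (simp add: Tbar_def T_mem T'_mem subspace_add subspace_diff U_subspace)

lemma Tb_P: "Tb (P x) = Tb x"
  by (simp add: Tbar_def T_P T'_P)

definition "t x y = A_inner A (Tb x) y"

lemma t_eq: "t x y = A_inner A (T x) y + A_inner A x (T y) - A_inner A (T x) (T y)"
  by (simp add: t_def Tbar_def energy.bilinear_simps T'_inner')

sublocale t: psd_form t
proof
  show "t x y = t y x" for x y
    by (simp add: t_eq energy.sym)
  show "0 \<le> t x x" for x
  proof -
    \<comment> \<open>Positivity is given on \<open>U\<close> only; it extends to the whole space
      because \<open>t x x\<close> depends on \<open>P x\<close> alone.\<close>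
    have "t x x = A_inner A (Tb (P x)) (P x)"
      by (metis P_inner Tb_P Tb_mem energy.sym t_def)
    also have "\<dots> \<ge> 0"
      using Tbar_pos_def P_mem[of x] by (cases "P x = 0") (auto simp: A_pos_def_on_def less_imp_le)
    finally show ?thesis .
  qed
qed (simp_all add: t_eq T_add T_scaleR energy.bilinear_simps algebra_simps)

lemma psd_form_t: "psd_form t"
  by (rule t.psd_form_axioms)

lemma t_P_left: "t (P x) y = t x y"
  by (simp add: t_def Tb_P)

lemma A_norm_error_power2: "(A_norm A (x - T x))\<^sup>2 = (A_norm A x)\<^sup>2 - t x x"
  using energy.sym[of x "T x"] by (simp add: A_norm_power2 t_eq energy.bilinear_simps)

lemma Tb_surj: "u \<in> U \<Longrightarrow> \<exists>y\<in>U. Tb y = u"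
  using Tbar_bij by (metis bij_betw_imp_surj_on imageE)

lemma S_mem: "u \<in> U \<Longrightarrow> S u \<in> U"
  using S_inv_sqrt by (auto simp: is_A_inv_sqrt_def linear_op_on_def)

text \<open>Symmetry of \<open>S\<close> moves one factor across the product, where
  \<open>S (S (Tb y)) = y\<close>. This removes the inverse square root from the cost.\<close>

lemma A_norm_S_Tb_power2:
  assumes "y \<in> U"
  shows "(A_norm A (S (Tb y)))\<^sup>2 = t y y"
proof -
  have "S (S (Tb y)) = y" using S_inv_sqrt assms by (simp add: is_A_inv_sqrt_def)
  moreover have "A_inner A (S (Tb y)) (S (Tb y)) = A_inner A (Tb y) (S (S (Tb y)))"
    using S_inv_sqrt by (simp add: is_A_inv_sqrt_def A_pos_def_on_def S_mem Tb_mem)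
  ultimately show ?thesis by (simp add: A_norm_power2 t_def)
qed

text \<open>The Riesz adjoint \<open>G\<close> of \<open>R Q\<close> gives \<open>T' = G A\<close>, so that the symmetrization factors as
  \<open>M A\<close> with \<open>M\<close> symmetric.\<close>

lemma Tb_factorization:
  obtains M where "\<And>x. Tb x = M (A x)"
    and "\<And>x y. M x \<bullet> y = x \<bullet> M y"
    and "\<And>x y. M (x - y) = M x - M y"
    and "\<And>x. M (Q x) = M x"
    and "\<And>x. M x \<in> U"
proof -
  obtain K where K: "norm (R x) \<le> K * norm x" if "x \<in> U" for x
    using R_linear by (auto simp: bounded_linear_op_on_def)
  have bound: "\<bar>R (Q x) \<bullet> y\<bar> \<le> (\<bar>K\<bar> * norm y) * norm x" for x y
  proof -
    have "\<bar>R (Q x) \<bullet> y\<bar> \<le> norm (R (Q x)) * norm y" by (rule Cauchy_Schwarz_ineq2)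
    moreover have "norm (R (Q x)) \<le> \<bar>K\<bar> * norm x"
    proof -
      have "norm (R (Q x)) \<le> K * norm (Q x)" by (rule K[OF Q_mem])
      also have "\<dots> \<le> \<bar>K\<bar> * norm (Q x)" by (simp add: mult_right_mono)
      also have "\<dots> \<le> \<bar>K\<bar> * norm x" by (simp add: mult_left_mono norm_Q_le)
      finally show ?thesis .
    qed
    ultimately show ?thesis
      by (smt (verit) mult.assoc mult.commute mult_right_mono norm_ge_zero)
  qed
  have "\<exists>g. \<forall>x. R (Q x) \<bullet> y = g \<bullet> x" for y
    by (rule Riesz_representation[of "\<lambda>x. R (Q x) \<bullet> y" "\<bar>K\<bar> * norm y"])
      (auto simp: Q_add Q_scaleR R_add R_scaleR Q_mem inner_add_left bound)
  then obtain G where G: "R (Q x) \<bullet> y = G y \<bullet> x" for x y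
    by metis
  have G_diff: "G (x - y) = G x - G y" for x y
  proof -
    have "(G (x - y) - (G x - G y)) \<bullet> z = 0" for z
      by (simp add: inner_diff_left inner_diff_right flip: G)
    then show ?thesis by (metis inner_eq_zero_iff eq_iff_diff_eq_0)
  qed
  have Q_Q: "Q (Q x) = Q x" for x by (simp add: Q_id Q_mem)
  have G_Q: "G (Q x) = G x" for x
  proof -
    have "(G (Q x) - G x) \<bullet> z = 0" for z
    proof -
      have "G (Q x) \<bullet> z = G x \<bullet> z"
        by (metis G Q_inner Q_mem R_mem inner_commute)
      then show ?thesis by (simp add: inner_diff_left)
    qed
    then show ?thesis by (metis inner_eq_zero_iff eq_iff_diff_eq_0)
  qed
  have G_mem: "G x \<in> U" for x
  proof -
    have "Q (G x) = G x"
    proof -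
      have "(Q (G x) - G x) \<bullet> z = 0" for z
      proof -
        have "Q (G x) \<bullet> z = G x \<bullet> Q z"
          by (metis Q_inner Q_mem inner_commute)
        also have "\<dots> = G x \<bullet> z" using G[of z x] G[of "Q z" x] by (simp add: Q_Q)
        finally show ?thesis by (simp add: inner_diff_left)
      qed
      then show ?thesis by (metis inner_eq_zero_iff eq_iff_diff_eq_0)
    qed
    then show ?thesis by (metis Q_mem)
  qed
  have T'_eq: "T' x = G (A x)" for x
  proof (rule A_inner_eqI)
    fix z
    have "A_inner A (T' x) z = T z \<bullet> A x"
      by (metis T'_inner' A_inner_def A_symmetric inner_commute)
    also have "\<dots> = G (A x) \<bullet> A z" by (simp add: Tsub_def G)
    finally show "A_inner A (T' x) z = A_inner A (G (A x)) z"
      by (simp add: A_inner_def A_symmetric)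
  qed
  \<comment> \<open>With \<open>T = R Q A\<close> and \<open>T' = G A\<close>, this is
    \<open>Tb\<close> with the rightmost \<open>A\<close> split off.\<close>
  define M where "M x = R (Q x) + G x - G (A (R (Q x)))" for x
  have RQ_diff: "R (Q (x - y)) = R (Q x) - R (Q y)" for x y
    using R_add[of "Q (x - y)" "Q y"] Q_add[of "x - y" y] by (simp add: Q_mem)
  show thesis
  proof (rule that[of M])
    show "Tb x = M (A x)" for x
      by (simp add: Tbar_def M_def T'_eq Tsub_def)
    show "M x \<bullet> y = x \<bullet> M y" for x y
    proof -
      have "M x \<bullet> y = R (Q x) \<bullet> y + R (Q y) \<bullet> x - R (Q y) \<bullet> A (R (Q x))"
        by (simp add: M_def inner_diff_left inner_add_left G)
      moreover have "M y \<bullet> x = R (Q y) \<bullet> x + R (Q x) \<bullet> y - R (Q x) \<bullet> A (R (Q y))"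
        by (simp add: M_def inner_diff_left inner_add_left G)
      moreover have "R (Q y) \<bullet> A (R (Q x)) = R (Q x) \<bullet> A (R (Q y))"
        by (metis A_symmetric inner_commute)
      ultimately show ?thesis by (simp add: inner_commute)
    qed
    show "M (x - y) = M x - M y" for x y
      using A_linear
      by (simp add: M_def RQ_diff G_diff linear_diff bounded_linear.linear)
    show "M (Q x) = M x" for x
      by (simp add: M_def Q_Q G_Q)
    show "M x \<in> U" for x
      by (simp add: M_def R_mem Q_mem G_mem subspace_add subspace_diff U_subspace)
  qed
qed

text \<open>Surjectivity of \<open>Tb\<close> gives \<open>x\<close> with
  \<open>M (A x) = M y\<close>, so the defect \<open>d = Q (A x) - y\<close> lies in the kernel of
  \<open>M\<close>. It lies in the range of \<open>M\<close> too, and for symmetric \<open>M\<close>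
  these are orthogonal, hence \<open>d = 0\<close>.\<close>

lemma Q_A_surj:
  assumes "y \<in> U"
  shows "\<exists>x\<in>U. Q (A x) = y"
proof -
  obtain M where M: "\<And>x. Tb x = M (A x)" "\<And>x y. M x \<bullet> y = x \<bullet> M y"
      "\<And>x y. M (x - y) = M x - M y" "\<And>x. M (Q x) = M x" "\<And>x. M x \<in> U"
    by (rule Tb_factorization) blast
  obtain x where x: "x \<in> U" "Tb x = M y" using Tb_surj M(5) by blast
  define d where "d = Q (A x) - y"
  have "d \<in> U" using assms by (simp add: d_def subspace_diff U_subspace Q_mem)
  then obtain z where "Tb z = d" using Tb_surj by blast
  then have z: "M (A z) = d" by (simp only: M(1))
  have "M (A x) = M y" using x(2) by (simp only: M(1))
  then have "M d = 0" by (simp add: d_def M(3) M(4))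
  then have "d \<bullet> d = 0" using M(2)[of "A z" d] unfolding z by simp
  then show ?thesis using x(1) by (auto simp: d_def)
qed

text \<open>This makes \<open>U\<close> complete with respect to \<open>t\<close> although \<open>A\<close> need not be coercive: every
  functional \<open>\<lambda>x. x \<bullet> y\<close> on \<open>U\<close> has the form \<open>t z\<close>, so the \<open>t\<close>-unit ball is weakly bounded.\<close>

lemma t_coercive:
  obtains C where "\<And>x. x \<in> U \<Longrightarrow> norm x \<le> C * sqrt (t x x)"
proof -
  define B where "B = {x \<in> U. t x x \<le> 1}"
  have "\<exists>M. \<forall>x\<in>B. \<bar>x \<bullet> y\<bar> \<le> M" for y
  proof -
    obtain z where z: "Q (A (Tb z)) = Q y"
      using Q_A_surj[OF Q_mem[of y]] Tb_surj by metis
    have "\<bar>x \<bullet> y\<bar> \<le> sqrt (t z z)" if "x \<in> B" for x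
    proof -
      have "x \<bullet> y = x \<bullet> A (Tb z)"
        using that z Q_inner[of x] by (metis (lifting) B_def inner_commute mem_Collect_eq)
      also have "\<dots> = t z x" by (simp add: t_def A_inner_def inner_commute)
      finally have "\<bar>x \<bullet> y\<bar> \<le> sqrt (t z z) * sqrt (t x x)"
        using t.Cauchy_Schwarz_sqrt[of z x] by simp
      also have "\<dots> \<le> sqrt (t z z) * 1"
        using that by (intro mult_left_mono) (auto simp: B_def t.nonneg)
      finally show ?thesis by simp
    qed
    then show ?thesis by blast
  qed
  then obtain C where C: "\<And>x. x \<in> B \<Longrightarrow> norm x \<le> C"
    using weakly_bounded_imp_bounded by metis
  have "norm x \<le> C * sqrt (t x x)" if x: "x \<in> U" for x
  proof (cases "x = 0")
    case False
    define r where "r = sqrt (t x x)"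
    have "A_inner A (Tb x) x > 0"
      using Tbar_pos_def False x unfolding A_pos_def_on_def by blast
    then have r: "r > 0" by (simp add: r_def t_def)
    have "t ((1 / r) *\<^sub>R x) ((1 / r) *\<^sub>R x) = t x x / r\<^sup>2"
      by (simp add: t.bilinear_simps power2_eq_square)
    also have "\<dots> = 1" using r by (simp add: r_def)
    finally have "(1 / r) *\<^sub>R x \<in> B" using x by (simp add: B_def subspace_scale U_subspace)
    from C[OF this] show ?thesis using r by (simp add: r_def[symmetric] field_simps)
  qed simp
  then show thesis by (rule that)
qed

text \<open>Projecting by \<open>P\<close> changes no value of \<open>t\<close> and moves the
  sequence into \<open>U\<close>, where coercivity turns \<open>t\<close>-Cauchy into
  norm-Cauchy.\<close>

lemma t_complete:
  assumes "\<And>e. e > 0 \<Longrightarrow> \<exists>N. \<forall>m\<ge>N. \<forall>n\<ge>N. t (X m - X n) (X m - X n) < e"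
  obtains y where "y \<in> U" "\<And>z. (\<lambda>n. t (X n) z) \<longlonglongrightarrow> t y z"
proof -
  obtain C where C: "\<And>x. x \<in> U \<Longrightarrow> norm x \<le> C * sqrt (t x x)" using t_coercive by blast
  have P_t: "t z (P x) = t z x" for x z
    by (metis t_P_left t.sym)
  have "Cauchy (\<lambda>n. P (X n))"
  proof (rule metric_CauchyI)
    fix e :: real assume e: "e > 0"
    define D where "D = \<bar>C\<bar> + 1"
    have D: "D > 0" by (simp add: D_def)
    obtain N where N: "\<forall>m\<ge>N. \<forall>n\<ge>N. t (X m - X n) (X m - X n) < (e / D)\<^sup>2"
      using assms[of "(e / D)\<^sup>2"] e D by auto
    have "dist (P (X m)) (P (X n)) < e" if "N \<le> m" "N \<le> n" for m n
    proof -
      define x where "x = P (X m) - P (X n)"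
      have "x \<in> U" by (simp add: x_def subspace_diff U_subspace P_mem)
      have "t x x = t (X m - X n) (X m - X n)"
        by (simp add: x_def t.diff_left t.diff_right t_P_left P_t)
      then have "sqrt (t x x) < e / D"
        using N that e D by (intro real_less_lsqrt) auto
      have "norm x \<le> C * sqrt (t x x)" by (rule C) fact
      also have "\<dots> \<le> D * sqrt (t x x)"
        by (intro mult_right_mono) (auto simp: D_def t.nonneg)
      also have "\<dots> < e" using \<open>sqrt (t x x) < e / D\<close> D by (simp add: field_simps)
      finally show ?thesis by (simp add: x_def dist_norm)
    qed
    then show "\<exists>N. \<forall>m\<ge>N. \<forall>n\<ge>N. dist (P (X m)) (P (X n)) < e" by blast
  qed
  then obtain y where y: "(\<lambda>n. P (X n)) \<longlonglongrightarrow> y"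
    using Cauchy_convergent_iff convergentD by blast
  \<comment> \<open>Projecting the norm limit once more puts it in \<open>U\<close> directly, again
    without changing \<open>t\<close>.\<close>
  have "(\<lambda>n. t (X n) z) \<longlonglongrightarrow> t (P y) z" for z
  proof -
    have "(\<lambda>n. A (Tb z) \<bullet> P (X n)) \<longlonglongrightarrow> A (Tb z) \<bullet> y"
      by (intro tendsto_inner tendsto_const y)
    moreover have "A (Tb z) \<bullet> P (X n) = t (X n) z" for n
      using P_t[of z "X n"] t.sym[of z "X n"] by (simp add: t_def A_inner_def)
    moreover have "A (Tb z) \<bullet> y = t (P y) z"
      using t.sym[of y z] by (simp add: t_P_left) (simp add: t_def A_inner_def)
    ultimately show ?thesis by simp
  qed
  then show thesis using that P_mem by blast
qed

end

subsection \<open>The error of one pass\<close>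

text \<open>The index is the position within the pass: a permutation is absorbed by reindexing the
  family, so the fixed order \<open>1, ..., J\<close> suffices here.\<close>

locale correction_family = energy_space A
  for A :: "'a::{real_inner, complete_space} \<Rightarrow> 'a" +
  fixes J :: nat and U :: "nat \<Rightarrow> 'a set" and Q P R T' S :: "nat \<Rightarrow> 'a \<Rightarrow> 'a"
  assumes solver: "k \<in> {1..J} \<Longrightarrow> subspace_solver A (U k) (Q k) (P k) (R k) (T' k) (S k)"
begin

abbreviation "T k \<equiv> Tsub A (R k) (Q k)"
abbreviation "Tb k \<equiv> Tbar (T k) (T' k)"
abbreviation "t k \<equiv> subspace_solver.t A (Q k) (R k) (T' k)"

definition err :: "nat \<Rightarrow> 'a \<Rightarrow> 'a" where
  "err k = fold (\<lambda>i w. w - T i w) [1..<Suc k]"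

lemma err_0 [simp]: "err 0 x = x"
  and err_Suc [simp]: "err (Suc k) x = err k x - T (Suc k) (err k x)"
  by (simp_all add: err_def)

lemma psd_form_t: "k \<in> {1..J} \<Longrightarrow> psd_form (t k)"
  using solver subspace_solver.psd_form_t by blast

lemma err_linear:
  assumes "k \<le> J"
  shows "err k (x + y) = err k x + err k y" and "err k (c *\<^sub>R x) = c *\<^sub>R err k x"
proof -
  have "err k (x + y) = err k x + err k y \<and> err k (c *\<^sub>R x) = c *\<^sub>R err k x"
    using assms
  proof (induction k)
    case (Suc k)
    then have "Suc k \<in> {1..J}" by simp
    note s = solver[OF this]
    show ?case using Suc
      by (simp add: subspace_solver.T_add[OF s] subspace_solver.T_scaleR[OF s] algebra_simps)
  qed simp
  then show "err k (x + y) = err k x + err k y" and "err k (c *\<^sub>R x) = c *\<^sub>R err k x"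
    by auto
qed

lemma err_diff: "k \<le> J \<Longrightarrow> err k (x - y) = err k x - err k y"
  using err_linear(1)[of k "x - y" y] by simp

text \<open>The polarized energy loss of a whole pass; \<open>err (i - 1)\<close> is the error on
  which step \<open>i\<close> acts.\<close>

definition loss :: "'a \<Rightarrow> 'a \<Rightarrow> real" where
  "loss x z = (\<Sum>i=1..J. t i (err (i - 1) x) (err (i - 1) z))"

lemma A_norm_err_power2:
  assumes "k \<le> J"
  shows "(\<Sum>i=1..k. t i (err (i - 1) x) (err (i - 1) x)) = (A_norm A x)\<^sup>2 - (A_norm A (err k x))\<^sup>2"
  using assms
proof (induction k)
  case (Suc k)
  then have "Suc k \<in> {1..J}" by simp
  note subspace_solver.A_norm_error_power2[OF solver[OF this], of "err k x"]
  then show ?case using Suc by simp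
qed simp

lemma loss_eq: "loss x x = (A_norm A x)\<^sup>2 - (A_norm A (err J x))\<^sup>2"
  unfolding loss_def by (rule A_norm_err_power2) simp

sublocale loss: psd_form loss
proof
  fix x y z :: 'a and c :: real
  show "loss (x + y) z = loss x z + loss y z"
    by (auto simp: loss_def err_linear psd_form.add_left[OF psd_form_t] simp flip: sum.distrib intro!: sum.cong)
  show "loss (c *\<^sub>R x) y = c * loss x y"
    by (auto simp: loss_def err_linear psd_form.scaleR_left[OF psd_form_t] sum_distrib_left intro!: sum.cong)
  show "loss x y = loss y x"
    unfolding loss_def by (intro sum.cong refl psd_form.sym[OF psd_form_t])
  show "0 \<le> loss x x"
    unfolding loss_def by (intro sum_nonneg psd_form.nonneg[OF psd_form_t])
qed

lemma A_norm_err_le: "A_norm A (err J x) \<le> A_norm A x"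
  using loss.nonneg[of x] by (auto simp: loss_eq intro: power2_le_imp_le A_norm_nonneg)

section \<open>Decompositions and the triangular system\<close>

definition corr :: "(nat \<Rightarrow> 'a) \<Rightarrow> nat \<Rightarrow> 'a" where
  "corr vs i = vs i + T' i (P i (\<Sum>j=i+1..J. vs j))"

definition cost :: "(nat \<Rightarrow> 'a) \<Rightarrow> real" where
  "cost vs = (\<Sum>i=1..J. (A_norm A (S i (corr vs i)))\<^sup>2)"

lemma corr_preimage:
  assumes "\<forall>i\<in>{1..J}. vs i \<in> U i"
  obtains y where "\<forall>i\<in>{1..J}. y i \<in> U i \<and> Tb i (y i) = corr vs i"
proof -
  have "\<exists>y\<in>U i. Tb i y = corr vs i" if i: "i \<in> {1..J}" for i
    using assms i subspace_solver.Tb_surj[OF solver[OF i]]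
      subspace_solver.T'_mem[OF solver[OF i]] subspace_solver.U_subspace[OF solver[OF i]]
    by (simp add: corr_def subspace_add)
  then show thesis using that by metis
qed

text \<open>Back substitution: \<open>corr vs i\<close> involves only \<open>vs i\<close> and later
  components, so the system is solved from \<open>J\<close> downwards.\<close>

lemma corr_surj:
  obtains vs where "\<forall>i\<in>{1..J}. vs i \<in> U i \<and> corr vs i = Tb i (y i)"
proof -
  have "\<exists>vs. \<forall>i\<in>{n<..J}. vs i \<in> U i \<and> corr vs i = Tb i (y i)" if "n \<le> J" for n
    using that
  proof (induction rule: inc_induct)
    case (step n)
    then obtain vs where vs: "\<forall>i\<in>{Suc n<..J}. vs i \<in> U i \<and> corr vs i = Tb i (y i)" by blast
    let ?m = "Suc n"
    \<comment> \<open>Setting component \<open>?m\<close> leaves the equations at larger indices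
      intact, since they contain only components beyond \<open>?m\<close>.\<close>
    define ws where "ws = vs(?m := Tb ?m (y ?m) - T' ?m (P ?m (\<Sum>j=?m+1..J. vs j)))"
    have sum_eq: "(\<Sum>j=i+1..J. ws j) = (\<Sum>j=i+1..J. vs j)" if "?m \<le> i" for i
      using that by (intro sum.cong) (auto simp: ws_def)
    have "?m \<in> {1..J}" using step by simp
    note s = solver[OF this]
    have "ws i \<in> U i \<and> corr ws i = Tb i (y i)" if i: "i \<in> {n<..J}" for i
    proof (cases "i = ?m")
      case True
      have "ws ?m \<in> U ?m"
        by (simp add: ws_def subspace_diff subspace_solver.U_subspace[OF s]
            subspace_solver.T'_mem[OF s] subspace_solver.Tb_mem[OF s])
      moreover have "corr ws ?m = Tb ?m (y ?m)"
        unfolding corr_def sum_eq[OF order_refl] by (simp add: ws_def)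
      ultimately show ?thesis using True by simp
    next
      case False
      then have "i \<in> {?m<..J}" using i by auto
      moreover from this have "corr ws i = corr vs i" "ws i = vs i"
        using sum_eq[of i] by (auto simp: corr_def ws_def)
      ultimately show ?thesis using vs by simp
    qed
    then show ?case by blast
  qed auto
  moreover have "{0<..J} = {1..J}" by auto
  ultimately show thesis using that by (metis zero_le)
qed

lemma A_inner_sum_eq:
  assumes "\<forall>i\<in>{1..J}. corr vs i = Tb i (y i)"
  shows "A_inner A (\<Sum>i=1..J. vs i) x = (\<Sum>i=1..J. t i (y i) (err (i - 1) x))"
proof -
  \<comment> \<open>The tail of the sum is paired with the current error. In \<open>corr\<close>,
    the \<open>T'\<close> term moves over as \<open>T\<close> on the error, which is what turns
    \<open>err k\<close> into \<open>err (Suc k)\<close> for the remaining tail; at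
    \<open>k = J\<close> the tail is empty.\<close>
  have "A_inner A (\<Sum>i=1..J. vs i) x =
      (\<Sum>i=1..k. t i (y i) (err (i - 1) x)) + A_inner A (\<Sum>j=k+1..J. vs j) (err k x)"
    if "k \<le> J" for k
    using that
  proof (induction k)
    case (Suc k)
    let ?m = "Suc k"
    let ?e = "err k x"
    let ?s = "\<Sum>j=?m+1..J. vs j"
    have m: "?m \<in> {1..J}" using Suc by simp
    note s = solver[OF m]
    have "(\<Sum>j=k+1..J. vs j) = vs ?m + ?s"
      using sum.atLeast_Suc_atMost[of "k + 1" J vs] Suc.prems by simp
    moreover have "t ?m (y ?m) ?e = A_inner A (corr vs ?m) ?e"
      using assms m by (simp add: subspace_solver.t_def[OF s])
    moreover have "A_inner A (corr vs ?m) ?e = A_inner A (vs ?m) ?e + A_inner A ?s (T ?m ?e)"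
      by (simp add: corr_def energy.add_left subspace_solver.T'_P[OF s] subspace_solver.T'_inner'[OF s])
    moreover have "err ?m x = ?e - T ?m ?e" by simp
    ultimately have "A_inner A (\<Sum>j=k+1..J. vs j) ?e = t ?m (y ?m) ?e + A_inner A ?s (err ?m x)"
      by (simp only: energy.bilinear_simps)
    then show ?case using Suc.IH Suc.prems by simp
  qed simp
  from this[of J] show ?thesis by simp
qed

lemma cost_eq:
  assumes "\<forall>i\<in>{1..J}. y i \<in> U i \<and> corr vs i = Tb i (y i)"
  shows "cost vs = (\<Sum>i=1..J. t i (y i) (y i))"
  unfolding cost_def
proof (rule sum.cong)
  fix i assume i: "i \<in> {1..J}"
  then have y: "y i \<in> U i" "corr vs i = Tb i (y i)" using assms by blast+
  show "(A_norm A (S i (corr vs i)))\<^sup>2 = t i (y i) (y i)"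
    unfolding y(2) by (rule subspace_solver.A_norm_S_Tb_power2[OF solver[OF i] y(1)])
qed (rule refl)

text \<open>Cauchy-Schwarz in each form, then in the \<open>J\<close>-dimensional Euclidean space of
  their square roots.\<close>

lemma sum_t_Cauchy_Schwarz:
  "(\<Sum>i=1..J. t i (f i) (g i))\<^sup>2 \<le> (\<Sum>i=1..J. t i (f i) (f i)) * (\<Sum>i=1..J. t i (g i) (g i))"
proof -
  have sqrt_t: "(\<Sum>i=1..J. (sqrt (t i (h i) (h i)))\<^sup>2) = (\<Sum>i=1..J. t i (h i) (h i))" for h
    by (intro sum.cong refl real_sqrt_pow2 psd_form.nonneg[OF psd_form_t])
  have "\<bar>\<Sum>i=1..J. t i (f i) (g i)\<bar> \<le> (\<Sum>i=1..J. \<bar>t i (f i) (g i)\<bar>)"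
    by (rule sum_abs)
  also have "\<dots> \<le> (\<Sum>i=1..J. sqrt (t i (f i) (f i)) * sqrt (t i (g i) (g i)))"
    by (rule sum_mono) (rule psd_form.Cauchy_Schwarz_sqrt[OF psd_form_t])
  finally have "\<bar>\<Sum>i=1..J. t i (f i) (g i)\<bar>\<^sup>2 \<le> (\<Sum>i=1..J. sqrt (t i (f i) (f i)) * sqrt (t i (g i) (g i)))\<^sup>2"
    by (rule power_mono) (rule abs_ge_zero)
  also have "\<dots> \<le> (\<Sum>i=1..J. (sqrt (t i (f i) (f i)))\<^sup>2) * (\<Sum>i=1..J. (sqrt (t i (g i) (g i)))\<^sup>2)"
    by (rule Cauchy_Schwarz_ineq_sum)
  finally show ?thesis by (simp only: sqrt_t power2_abs)
qed

lemma cost_lower_bound: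
  assumes "vs \<in> decompositions U J v"
  shows "((A_norm A v)\<^sup>2)\<^sup>2 \<le> cost vs * ((A_norm A v)\<^sup>2 - (A_norm A (err J v))\<^sup>2)"
proof -
  have vs: "\<forall>i\<in>{1..J}. vs i \<in> U i" "(\<Sum>i=1..J. vs i) = v"
    using assms by (auto simp: decompositions_def)
  then obtain y where y: "\<forall>i\<in>{1..J}. y i \<in> U i \<and> Tb i (y i) = corr vs i"
    using corr_preimage by blast
  then have "(A_norm A v)\<^sup>2 = (\<Sum>i=1..J. t i (y i) (err (i - 1) v))"
    using A_inner_sum_eq[of vs y v] vs by (simp add: A_norm_power2)
  moreover have "cost vs = (\<Sum>i=1..J. t i (y i) (y i))"
    using y by (intro cost_eq) simp
  moreover have "(\<Sum>i=1..J. t i (y i) (err (i - 1) v))\<^sup>2 \<le> (\<Sum>i=1..J. t i (y i) (y i)) * loss v v"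
    unfolding loss_def by (rule sum_t_Cauchy_Schwarz)
  ultimately show ?thesis by (metis loss_eq)
qed

text \<open>The gap makes pairing with \<open>v\<close> bounded with respect to \<open>loss\<close>,
  with constant \<open>C\<close>. The weak limits of the Riesz sequence, taken step by step, give a
  decomposition that meets the bound itself.\<close>

lemma cost_upper_bound:
  assumes "\<delta> > 0"
    and gap: "\<And>x. \<delta> * (A_norm A x)\<^sup>2 \<le> (A_norm A x)\<^sup>2 - (A_norm A (err J x))\<^sup>2"
  obtains vs where "vs \<in> decompositions U J v" "cost vs \<le> (A_norm A v)\<^sup>2 / \<delta>"
proof -
  define C where "C = A_norm A v / sqrt \<delta>"
  have "\<bar>A_inner A v x\<bar> \<le> C * sqrt (loss x x)" for x
  proof -
    have "sqrt \<delta> * A_norm A x = sqrt (\<delta> * (A_norm A x)\<^sup>2)"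
      by (simp add: real_sqrt_mult A_norm_nonneg)
    also have "\<dots> \<le> sqrt (loss x x)"
      using gap[of x] by (simp add: loss_eq)
    finally have "A_norm A x \<le> sqrt (loss x x) / sqrt \<delta>"
      using assms(1) by (simp add: field_simps)
    then have "A_norm A v * A_norm A x \<le> A_norm A v * (sqrt (loss x x) / sqrt \<delta>)"
      by (rule mult_left_mono) (rule A_norm_nonneg)
    then show ?thesis
      using energy.Cauchy_Schwarz_sqrt[of v x] by (simp add: C_def A_norm_def)
  qed
  then obtain X where X: "\<And>n. loss (X n) (X n) \<le> C\<^sup>2"
      "\<And>e. e > 0 \<Longrightarrow> \<exists>N. \<forall>m\<ge>N. \<forall>n\<ge>N. loss (X m - X n) (X m - X n) < e"
      "\<And>z. (\<lambda>n. loss (X n) z) \<longlonglongrightarrow> A_inner A v z"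
    by (rule loss.Riesz_sequence[OF energy.add_right energy.scaleR_right]) blast
  have "\<exists>y\<in>U i. \<forall>z. (\<lambda>n. t i (err (i - 1) (X n)) z) \<longlonglongrightarrow> t i y z" if i: "i \<in> {1..J}" for i
  proof -
    have i1: "i - 1 \<le> J" using i by auto
    \<comment> \<open>Each summand is dominated by \<open>loss\<close>, so the errors before step
      \<open>i\<close> inherit the Cauchy property in \<open>t i\<close>.\<close>
    have le: "t i (err (i - 1) x) (err (i - 1) x) \<le> loss x x" for x
      unfolding loss_def using i
      by (intro member_le_sum[of i "{1..J}" "\<lambda>i. t i (err (i - 1) x) (err (i - 1) x)"])
        (auto simp: psd_form.nonneg[OF psd_form_t])
    have "\<exists>N. \<forall>m\<ge>N. \<forall>n\<ge>N. t i (err (i - 1) (X m) - err (i - 1) (X n)) (err (i - 1) (X m) - err (i - 1) (X n)) < e"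
      if "e > 0" for e
      using X(2)[OF that] le unfolding err_diff[OF i1, symmetric] by (meson le_less_trans)
    then show ?thesis
      using subspace_solver.t_complete[OF solver[OF i], of "\<lambda>n. err (i - 1) (X n)"] by metis
  qed
  then obtain y where y: "\<forall>i\<in>{1..J}. y i \<in> U i"
      "\<And>i z. i \<in> {1..J} \<Longrightarrow> (\<lambda>n. t i (err (i - 1) (X n)) z) \<longlonglongrightarrow> t i (y i) z"
    by metis
  obtain vs where vs: "\<forall>i\<in>{1..J}. vs i \<in> U i \<and> corr vs i = Tb i (y i)"
    by (rule corr_surj)
  have "(\<Sum>i=1..J. vs i) = v"
  proof (rule A_inner_eqI)
    fix z
    have "(\<lambda>n. loss (X n) z) \<longlonglongrightarrow> (\<Sum>i=1..J. t i (y i) (err (i - 1) z))"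
      unfolding loss_def by (intro tendsto_sum y)
    then have "A_inner A v z = (\<Sum>i=1..J. t i (y i) (err (i - 1) z))"
      using X(3) LIMSEQ_unique by blast
    then show "A_inner A (\<Sum>i=1..J. vs i) z = A_inner A v z"
      using vs A_inner_sum_eq[of vs y z] by simp
  qed
  then have "vs \<in> decompositions U J v"
    using vs by (simp add: decompositions_def)
  moreover have "cost vs \<le> C\<^sup>2"
  proof -
    have cost: "cost vs = (\<Sum>i=1..J. t i (y i) (y i))"
      using vs y(1) by (intro cost_eq) simp
    have cost_nonneg: "0 \<le> cost vs" by (simp add: cost_def sum_nonneg)
    \<comment> \<open>The convergence is weak, so the cost is recovered by testing against
      \<open>y\<close> itself; Cauchy-Schwarz then bounds its square by
      \<open>C\<^sup>2 * cost vs\<close>, and one factor cancels.\<close>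
    have "(\<lambda>n. (\<Sum>i=1..J. t i (err (i - 1) (X n)) (y i))\<^sup>2) \<longlonglongrightarrow> (cost vs)\<^sup>2"
      unfolding cost by (intro tendsto_power tendsto_sum y)
    moreover have "(\<Sum>i=1..J. t i (err (i - 1) (X n)) (y i))\<^sup>2 \<le> C\<^sup>2 * cost vs" for n
    proof -
      have "(\<Sum>i=1..J. t i (err (i - 1) (X n)) (y i))\<^sup>2 \<le> loss (X n) (X n) * cost vs"
        unfolding cost loss_def by (rule sum_t_Cauchy_Schwarz)
      also have "\<dots> \<le> C\<^sup>2 * cost vs" using X(1) cost_nonneg by (rule mult_right_mono)
      finally show ?thesis .
    qed
    ultimately have "(cost vs)\<^sup>2 \<le> C\<^sup>2 * cost vs"
      by (meson LIMSEQ_le_const2)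
    then show ?thesis
      using cost_nonneg by (cases "cost vs = 0") (simp_all add: power2_eq_square)
  qed
  moreover have "C\<^sup>2 = (A_norm A v)\<^sup>2 / \<delta>"
    using assms(1) by (simp add: C_def power_divide)
  ultimately show thesis using that by simp
qed

section \<open>From cost bounds to the operator norm\<close>

lemma A_onorm_err:
  shows A_norm_err_le_onorm: "A_norm A (err J v) \<le> A_onorm A (err J) * A_norm A v"
    and A_onorm_err_nonneg: "0 \<le> A_onorm A (err J)"
    and A_onorm_err_le_1: "A_onorm A (err J) \<le> 1"
proof -
  have le1: "A_norm A (err J v) / A_norm A v \<le> 1" for v
    using A_norm_err_le[of v] A_norm_nonneg[of v] by (simp add: divide_le_eq)
  have upper: "A_norm A (err J v) / A_norm A v \<le> A_onorm A (err J)" for v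
    unfolding A_onorm_def by (rule cSUP_upper) (auto intro: bdd_aboveI2 le1)
  show "A_norm A (err J v) \<le> A_onorm A (err J) * A_norm A v"
  proof (cases "A_norm A v = 0")
    case False
    then show ?thesis using upper[of v] A_norm_nonneg[of v] by (simp add: divide_le_eq)
  qed (use A_norm_err_le[of v] in simp)
  \<comment> \<open>The quotient at the zero vector is 0, as division by zero yields 0.\<close>
  show "0 \<le> A_onorm A (err J)"
    using upper[of 0] by (simp add: A_norm_def)
  show "A_onorm A (err J) \<le> 1"
    unfolding A_onorm_def by (rule cSUP_least) (auto intro: le1)
qed

text \<open>The lower cost bound gives \<open>c \<ge> 1 / gap v\<close> for each unit
  \<open>v\<close>, the upper one \<open>c \<le> 1 / \<delta>\<close> once
  \<open>\<delta> > 0\<close>. An infinite \<open>c\<close> corresponds to an error operator of norm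
  1.\<close>

theorem inverse_cost_eq:
  assumes nontrivial: "\<exists>v::'a. v \<noteq> 0"
    and decomp: "\<And>v. decompositions U J v \<noteq> {}"
  defines "c \<equiv> SUP v\<in>{v. A_norm A v = 1}. INF vs\<in>decompositions U J v. ereal (cost vs)"
  shows "1 / c = ereal (1 - (A_onorm A (err J))\<^sup>2)"
proof -
  define r where "r = A_onorm A (err J)"
  define \<delta> where "\<delta> = 1 - r\<^sup>2"
  define gap where "gap v = 1 - (A_norm A (err J v))\<^sup>2" for v
  have r: "0 \<le> r" "r \<le> 1" by (simp_all add: r_def A_onorm_err)
  then have \<delta>: "0 \<le> \<delta>" by (simp add: \<delta>_def power_le_one)
  have unit: "A_norm A ((1 / A_norm A v) *\<^sub>R v) = 1" if "v \<noteq> 0" for v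
    using that A_norm_nonneg[of v] by (simp add: A_norm_scaleR A_norm_eq_0_iff)
  obtain v\<^sub>0 where v\<^sub>0: "A_norm A v\<^sub>0 = 1" using nontrivial unit by blast
  have gap_pos: "0 < gap v" and INF_ge: "ereal (1 / gap v) \<le> (INF vs\<in>decompositions U J v. ereal (cost vs))"
    if v: "A_norm A v = 1" for v
  proof -
    have ge: "1 \<le> cost vs * gap v" if "vs \<in> decompositions U J v" for vs
      using cost_lower_bound[OF that] v by (simp add: gap_def)
    have "0 \<le> gap v" using loss.nonneg[of v] v by (simp add: loss_eq gap_def)
    \<comment> \<open>A zero gap would give \<open>1 \<le> 0\<close> for any decomposition of
      \<open>v\<close>, and one exists.\<close>
    moreover have "gap v \<noteq> 0" using decomp[of v] ge by fastforce
    ultimately show "0 < gap v" by simp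
    then show "ereal (1 / gap v) \<le> (INF vs\<in>decompositions U J v. ereal (cost vs))"
      using ge by (intro INF_greatest) (simp add: divide_le_eq)
  qed
  have c_ge: "ereal (1 / gap v) \<le> c" if "A_norm A v = 1" for v
    unfolding c_def by (rule SUP_upper2[of v]) (use that INF_ge in simp_all)
  have c_le: "c \<le> ereal (1 / \<delta>)" if "\<delta> > 0"
    unfolding c_def
  proof (rule SUP_least)
    fix v assume "v \<in> {v. A_norm A v = 1}"
    then have v: "A_norm A v = 1" by simp
    have "\<delta> * (A_norm A x)\<^sup>2 \<le> (A_norm A x)\<^sup>2 - (A_norm A (err J x))\<^sup>2" for x
    proof -
      have "(A_norm A (err J x))\<^sup>2 \<le> (r * A_norm A x)\<^sup>2"
        using A_norm_err_le_onorm[of x] A_norm_nonneg by (intro power_mono) (simp_all add: r_def)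
      then show ?thesis by (simp add: \<delta>_def algebra_simps)
    qed
    then obtain vs where "vs \<in> decompositions U J v" "cost vs \<le> 1 / \<delta>"
      using cost_upper_bound[OF \<open>\<delta> > 0\<close>, of v] v by auto
    then show "(INF vs\<in>decompositions U J v. ereal (cost vs)) \<le> ereal (1 / \<delta>)"
      by (intro INF_lower2) simp_all
  qed
  have c_ge_1: "1 \<le> c"
  proof -
    have "1 \<le> 1 / gap v\<^sub>0" using gap_pos[OF v\<^sub>0] by (simp add: gap_def)
    then have "1 \<le> ereal (1 / gap v\<^sub>0)" by (simp add: one_ereal_def)
    then show ?thesis using c_ge[OF v\<^sub>0] by (rule order_trans)
  qed
  \<comment> \<open>A finite \<open>c\<close> bounds the gap below by \<open>1 / C\<close> uniformly
    over the unit sphere; homogeneity carries this over to the operator norm.\<close>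
  have \<delta>_ge: "1 / C \<le> \<delta>" if C: "c = ereal C" for C
  proof -
    have "C \<ge> 1" using c_ge_1 C by (simp add: one_ereal_def)
    have err_unit: "(A_norm A (err J v))\<^sup>2 \<le> 1 - 1 / C" if "A_norm A v = 1" for v
    proof -
      have "1 / gap v \<le> C" using c_ge[OF that] C by simp
      then have "1 / C \<le> gap v" using gap_pos[OF that] \<open>C \<ge> 1\<close> by (simp add: field_simps)
      then show ?thesis by (simp add: gap_def)
    qed
    have "r \<le> sqrt (1 - 1 / C)"
      unfolding r_def A_onorm_def
    proof (rule cSUP_least)
      fix v
      show "A_norm A (err J v) / A_norm A v \<le> sqrt (1 - 1 / C)"
      proof (cases "v = 0")
        case True
        then show ?thesis using \<open>C \<ge> 1\<close> by (simp add: A_norm_def)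
      next
        case False
        then have "A_norm A (err J ((1 / A_norm A v) *\<^sub>R v)) \<le> sqrt (1 - 1 / C)"
          using err_unit[OF unit] by (intro real_le_rsqrt)
        then show ?thesis using A_norm_nonneg[of v]
          by (simp add: err_linear A_norm_scaleR)
      qed
    qed simp
    then have "r\<^sup>2 \<le> (sqrt (1 - 1 / C))\<^sup>2" using r by (intro power_mono)
    then show ?thesis using \<open>C \<ge> 1\<close> by (simp add: \<delta>_def)
  qed
  have "1 / c = ereal \<delta>"
  proof (cases c)
    case (real C)
    then have "C \<ge> 1" using c_ge_1 by (simp add: one_ereal_def)
    have "1 / C \<le> \<delta>" using \<delta>_ge real by simp
    moreover from this have "\<delta> > 0" using \<open>C \<ge> 1\<close> by (smt (verit) divide_pos_pos)
    then have "C \<le> 1 / \<delta>" using c_le real by simp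
    then have "\<delta> \<le> 1 / C" using \<open>\<delta> > 0\<close> \<open>C \<ge> 1\<close> by (simp add: field_simps)
    ultimately show ?thesis using \<open>C \<ge> 1\<close> real by (simp add: one_ereal_def)
  next
    case PInf
    \<comment> \<open>A positive \<open>\<delta>\<close> would make \<open>c\<close> finite; the
      extended reals give \<open>1 / c = 0\<close> here.\<close>
    then have "\<delta> = 0" using c_le \<delta> by fastforce
    then show ?thesis using PInf by simp
  next
    case MInf
    then show ?thesis using c_ge_1 by simp
  qed
  then show ?thesis by (simp add: \<delta>_def r_def)
qed

end

section \<open>Averaging over all orders\<close>

text \<open>Bridges two indexings: \<open>ssc_c\<close> decomposes along \<open>V\<close> and
  evaluates at \<open>\<sigma> i\<close>, whereas \<open>correction_family\<close> numbers the
  subspaces by position.\<close>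

lemma decompositions_permute:
  assumes \<sigma>: "\<sigma> permutes {1..J}"
  shows "decompositions (\<lambda>i. V (\<sigma> i)) J v = (\<lambda>vs i. vs (\<sigma> i)) ` decompositions V J v"
proof -
  have sum: "(\<Sum>i=1..J. vs (\<sigma> i)) = (\<Sum>i=1..J. vs i)" for vs :: "nat \<Rightarrow> 'a"
    using sum.permute[OF \<sigma>, of vs] by (simp add: o_def)
  have mem: "\<sigma> i \<in> {1..J} \<longleftrightarrow> i \<in> {1..J}" for i
    using \<sigma> by (rule permutes_in_image)
  show ?thesis
  proof (intro equalityI subsetI)
    fix ws assume ws: "ws \<in> decompositions (\<lambda>i. V (\<sigma> i)) J v"
    define vs where "vs i = ws (inv \<sigma> i)" for i
    have "ws = (\<lambda>i. vs (\<sigma> i))"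
      using permutes_inverses[OF \<sigma>] by (simp add: vs_def)
    moreover have "vs \<in> decompositions V J v"
    proof -
      have "vs i \<in> V i" if "i \<in> {1..J}" for i
        using ws that mem[of "inv \<sigma> i"] permutes_inverses(1)[OF \<sigma>, of i]
        unfolding decompositions_def vs_def by (metis (mono_tags, lifting) mem_Collect_eq)
      moreover have "(\<Sum>i=1..J. vs i) = v"
        using ws sum[of vs] by (simp add: decompositions_def calculation \<open>ws = _\<close>)
      ultimately show ?thesis by (simp add: decompositions_def)
    qed
    ultimately show "ws \<in> (\<lambda>vs i. vs (\<sigma> i)) ` decompositions V J v" by blast
  next
    fix ws assume "ws \<in> (\<lambda>vs i. vs (\<sigma> i)) ` decompositions V J v"
    then show "ws \<in> decompositions (\<lambda>i. V (\<sigma> i)) J v"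
      using sum mem by (auto simp: decompositions_def)
  qed
qed

theorem theorem4:
  fixes A :: "'a::{real_inner, complete_space} \<Rightarrow> 'a"
    and J :: nat
    and V :: "nat \<Rightarrow> 'a set"
    and Q P R T Tadj S :: "nat \<Rightarrow> 'a \<Rightarrow> 'a"
  assumes nontrivial: "\<exists>v::'a. v \<noteq> 0"
    and A_linear: "bounded_linear A"
    and A_spd: "symmetric_pos_def A"
    and V_subspace: "\<And>i. i \<in> {1..J} \<Longrightarrow> subspace (V i)"
    and V_sum: "\<And>v. decompositions V J v \<noteq> {}"
    and Q_proj: "\<And>i. i \<in> {1..J} \<Longrightarrow> is_projection (\<bullet>) (V i) (Q i)"
    and P_proj: "\<And>i. i \<in> {1..J} \<Longrightarrow> is_projection (A_inner A) (V i) (P i)"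
    and R_linear: "\<And>i. i \<in> {1..J} \<Longrightarrow> bounded_linear_op_on (V i) (R i)"
    and R_nonsingular: "\<And>i. i \<in> {1..J} \<Longrightarrow> bij_betw (R i) (V i) (V i)"
    and T_def: "\<And>i. i \<in> {1..J} \<Longrightarrow> T i = Tsub A (R i) (Q i)"
    and T_adjoint: "\<And>i. i \<in> {1..J} \<Longrightarrow> is_A_adjoint A (T i) (Tadj i)"
    and Tbar_pos_def: "\<And>i. i \<in> {1..J} \<Longrightarrow> A_pos_def_on A (V i) (Tbar (T i) (Tadj i))"
    and Tbar_invertible: "\<And>i. i \<in> {1..J} \<Longrightarrow> bij_betw (Tbar (T i) (Tadj i)) (V i) (V i)"
    and S_inv_sqrt: "\<And>i. i \<in> {1..J} \<Longrightarrow> is_A_inv_sqrt A (V i) (Tbar (T i) (Tadj i)) (S i)"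
  shows "ereal (measure_pmf.expectation (pmf_of_set {\<sigma>. \<sigma> permutes {1..J}})
           (\<lambda>\<sigma>. (A_onorm A (\<lambda>v. v - ssc_B A R Q J \<sigma> (A v)))\<^sup>2))
       = 1 - ereal (1 / fact J) * (\<Sum>\<sigma> | \<sigma> permutes {1..J}. 1 / ssc_c A V P Tadj S J \<sigma>)"
proof -
  define N where "N \<sigma> = (A_onorm A (\<lambda>v. v - ssc_B A R Q J \<sigma> (A v)))\<^sup>2" for \<sigma>
  let ?\<Pi> = "{\<sigma>. \<sigma> permutes {1..J}}"
  \<comment> \<open>The identity holds for each single order; in particular every
    \<open>1 / c\<close> is a real number, so the average can be computed in the reals.\<close>
  have inverse_c: "1 / ssc_c A V P Tadj S J \<sigma> = ereal (1 - N \<sigma>)" if \<sigma>: "\<sigma> permutes {1..J}" for \<sigma>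
  proof -
    interpret correction_family A J "\<lambda>i. V (\<sigma> i)" "\<lambda>i. Q (\<sigma> i)" "\<lambda>i. P (\<sigma> i)" "\<lambda>i. R (\<sigma> i)"
      "\<lambda>i. Tadj (\<sigma> i)" "\<lambda>i. S (\<sigma> i)"
    proof (intro correction_family.intro energy_space.intro correction_family_axioms.intro A_linear A_spd)
      fix k assume "k \<in> {1..J}"
      then have k: "\<sigma> k \<in> {1..J}" using permutes_in_image[OF \<sigma>] by blast
      show "subspace_solver A (V (\<sigma> k)) (Q (\<sigma> k)) (P (\<sigma> k)) (R (\<sigma> k)) (Tadj (\<sigma> k)) (S (\<sigma> k))"
        using T_adjoint[OF k] Tbar_pos_def[OF k] Tbar_invertible[OF k] S_inv_sqrt[OF k]
        unfolding T_def[OF k]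
        by (intro subspace_solver.intro energy_space.intro subspace_solver_axioms.intro
            A_linear A_spd V_subspace[OF k] Q_proj[OF k] P_proj[OF k] R_linear[OF k])
    qed
    have "ssc_c A V P Tadj S J \<sigma> =
        (SUP v\<in>{v. A_norm A v = 1}. INF vs\<in>decompositions (\<lambda>i. V (\<sigma> i)) J v. ereal (cost vs))"
      by (simp add: ssc_c_def decompositions_permute[OF \<sigma>] cost_def corr_def image_image)
    moreover have "(\<lambda>v. v - ssc_B A R Q J \<sigma> (A v)) = err J"
      by (rule ext) (simp only: ssc_B_error[OF bounded_linear.linear[OF A_linear]] err_def)
    moreover have "decompositions (\<lambda>i. V (\<sigma> i)) J v \<noteq> {}" for v
      using V_sum by (simp add: decompositions_permute[OF \<sigma>])
    ultimately show ?thesis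
      using inverse_cost_eq[OF nontrivial] by (simp add: N_def)
  qed
  have fin: "finite ?\<Pi>" and card: "card ?\<Pi> = fact J"
    by (simp_all add: finite_permutations card_permutations)
  have "?\<Pi> \<noteq> {}" using permutes_id by blast
  then have "measure_pmf.expectation (pmf_of_set ?\<Pi>) N = (\<Sum>\<sigma>\<in>?\<Pi>. N \<sigma>) / fact J"
    using fin card by (simp add: integral_pmf_of_set)
  also have "\<dots> = 1 - (1 / fact J) * (\<Sum>\<sigma>\<in>?\<Pi>. 1 - N \<sigma>)"
    using card by (simp add: sum_subtractf field_simps)
  also have "ereal \<dots> = 1 - ereal (1 / fact J) * (\<Sum>\<sigma>\<in>?\<Pi>. ereal (1 - N \<sigma>))"
    by (simp add: one_ereal_def)
  also have "(\<Sum>\<sigma>\<in>?\<Pi>. ereal (1 - N \<sigma>)) = (\<Sum>\<sigma>\<in>?\<Pi>. 1 / ssc_c A V P Tadj S J \<sigma>)"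
    by (intro sum.cong) (simp_all add: inverse_c)
  finally show ?thesis by (simp only: N_def)
qed

end
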